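(* Let $\mathcal F$ be an algebraically closed and inversive $\sigma$-field of characteristic zero, $\mathcal I\subset\mathcal F\{\mathbb Y^\pm\}$ a Laurent binomial $\sigma$-ideal, $L$ the support lattice of $\mathcal I$, and $L_S=\mathrm{sat}(L)$ the saturation of $L$. Then the perfect closure $\{\mathcal I\}$ is either $[1]$ or can be written as the intersection of Laurent reflexive prime binomial $\sigma$-ideals whose support lattice is $L_S$.
   Context: A $\sigma$-field is a field $\mathcal F$ with a ring endomorphism $\sigma$ with $\sigma(a)=0$ iff $a=0$; inversive means $\sigma$ bijective. $\mathbb Y=\{y_1,\ldots,y_n\}$ are difference indeterminates. For $p=\sum_i c_ix^i\in\mathbb Z[x]$, $a^p:=\prod_i\sigma^i(a)^{c_i}$; for $\mathbf f\in\mathbb Z[x]^n$, $\mathbb Y^{\mathbf f}:=\prod_iy_i^{f_i}$. $\mathcal F\{\mathbb Y^\pm\}$ is the ring of Laurent difference polynomials (finite $\mathcal F$-linear combinations of the $\mathbb Y^{\mathbf f}$). A $\sigma$-ideal is an ideal closed under $\sigma$; $[1]$ is the unit ideal. A Laurent binomial $\sigma$-ideal is a $\sigma$-ideal of $\mathcal F\{\mathbb Y^\pm\}$ generated by elements $a\mathbb Y^{\mathbf g}+b\mathbb Y^{\mathbf h}$, $a,b\in\mathcal F$; its support lattice is $\{\mathbf f\in\mathbb Z[x]^n\mid\exists c\in\mathcal F\setminus\{0\},\ \mathbb Y^{\mathbf f}-c\in\mathcal I\}$. A $\sigma$-ideal is reflexive if $\sigma(a)\in\mathcal I$ implies $a\in\mathcal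 I$; prime if it is a prime ideal; perfect if $p^a\in\mathcal I$ with $a\in\mathbb N[x]\setminus\{0\}$ implies $p\in\mathcal I$. $\{\mathcal I\}$ is the smallest perfect $\sigma$-ideal containing $\mathcal I$. The saturation of a $\mathbb Z[x]$-submodule $L\subset\mathbb Z[x]^n$ is $\mathrm{sat}(L)=\{\mathbf f\in\mathbb Z[x]^n\mid\exists a\in\mathbb Z\setminus\{0\},\ \exists k\in\mathbb N,\ ax^k\mathbf f\in L\}$. *)

theory Defs
  imports
    "HOL-Analysis.Finite_Cartesian_Product"
    "HOL-Computational_Algebra.Polynomial"
    "HOL-Library.Poly_Mapping"
begin

definition sigma_field :: "('a::field \<Rightarrow> 'a) \<Rightarrow> bool" where
  "sigma_field \<sigma> \<longleftrightarrow>
     \<sigma> 1 = 1 \<and> (\<forall>a b. \<sigma> (a + b) = \<sigma> a + \<sigma> b) \<and> (\<forall>a b. \<sigma> (a * b) = \<sigma> a * \<sigma> b) \<and>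
     (\<forall>a. \<sigma> a = 0 \<longleftrightarrow> a = 0)"

definition inversive_sigma_field :: "('a::field \<Rightarrow> 'a) \<Rightarrow> bool" where
  "inversive_sigma_field \<sigma> \<longleftrightarrow> sigma_field \<sigma> \<and> bij \<sigma>"

text \<open>
  Ideals of a commutative ring equipped with an operator \<open>s\<close>.
  An ideal is a submodule of the ring regarded as a module over itself.
\<close>

definition sigma_ideal :: "('r::comm_ring_1 \<Rightarrow> 'r) \<Rightarrow> 'r set \<Rightarrow> bool" where
  "sigma_ideal s I \<longleftrightarrow> module.subspace (*) I \<and> (\<forall>p\<in>I. s p \<in> I)"

lemma module_times: "module ((*) :: 'r \<Rightarrow> 'r \<Rightarrow> 'r::comm_ring_1)"
  by unfold_locales (simp_all add: algebra_simps)

lemma sigma_ideal_iff: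
  "sigma_ideal s I \<longleftrightarrow>
     0 \<in> I \<and> (\<forall>p\<in>I. \<forall>q\<in>I. p + q \<in> I) \<and> (\<forall>r. \<forall>p\<in>I. r * p \<in> I) \<and> (\<forall>p\<in>I. s p \<in> I)"
  unfolding sigma_ideal_def module.subspace_def[OF module_times] by blast

definition reflexive_sigma_ideal :: "('r::comm_ring_1 \<Rightarrow> 'r) \<Rightarrow> 'r set \<Rightarrow> bool" where
  "reflexive_sigma_ideal s I \<longleftrightarrow> sigma_ideal s I \<and> (\<forall>p. s p \<in> I \<longrightarrow> p \<in> I)"

definition prime_sigma_ideal :: "('r::comm_ring_1 \<Rightarrow> 'r) \<Rightarrow> 'r set \<Rightarrow> bool" where
  "prime_sigma_ideal s I \<longleftrightarrow>
     sigma_ideal s I \<and> I \<noteq> UNIV \<and> (\<forall>p q. p * q \<in> I \<longrightarrow> p \<in> I \<or> q \<in> I)"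

text \<open>\<open>sigma_power s p a\<close> is $p^a = \prod_i \sigma^i(p)^{a_i}$ for $a = \sum_i a_i x^i$ in $N[x]$.\<close>

definition sigma_power :: "('r::comm_ring_1 \<Rightarrow> 'r) \<Rightarrow> 'r \<Rightarrow> nat poly \<Rightarrow> 'r" where
  "sigma_power s p a = (\<Prod>i\<le>degree a. ((s ^^ i) p) ^ coeff a i)"

definition perfect_sigma_ideal :: "('r::comm_ring_1 \<Rightarrow> 'r) \<Rightarrow> 'r set \<Rightarrow> bool" where
  "perfect_sigma_ideal s I \<longleftrightarrow>
     sigma_ideal s I \<and> (\<forall>p a. a \<noteq> 0 \<longrightarrow> sigma_power s p a \<in> I \<longrightarrow> p \<in> I)"

definition perfect_closure :: "('r::comm_ring_1 \<Rightarrow> 'r) \<Rightarrow> 'r set \<Rightarrow> 'r set" where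
  "perfect_closure s I = perfect_sigma_ideal s hull I"

text \<open>
  The ring of Laurent difference polynomials in indeterminates indexed by \<open>'n\<close> is the group
  algebra of the additive group $Z[x]^n$: the basis element \<open>single f 1\<close> is the
  monomial $Y^f$, in particular $y_i$ is \<open>single (axis i 1) 1\<close>, and \<open>(*)\<close> is convolution, so
  that $Y^f Y^g = Y^{f+g}$.
\<close>

type_synonym ('a, 'n) laurent = "(int poly ^ 'n) \<Rightarrow>\<^sub>0 'a"

text \<open>
  The difference operator sends $c Y^f$ to $\sigma(c) Y^{xf}$, where $x$ is \<open>monom 1 1\<close>.
\<close>

definition laurent_sigma :: "('a::field \<Rightarrow> 'a) \<Rightarrow> ('a, 'n::finite) laurent \<Rightarrow> ('a, 'n) laurent" where
  "laurent_sigma \<sigma> p =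
     (\<Sum>f\<in>Poly_Mapping.keys p.
        Poly_Mapping.single (monom 1 1 *s f) (\<sigma> (Poly_Mapping.lookup p f)))"

definition laurent_binomial :: "('a::field, 'n::finite) laurent \<Rightarrow> bool" where
  "laurent_binomial p \<longleftrightarrow>
     (\<exists>a b g h. p = Poly_Mapping.single g a + Poly_Mapping.single h b)"

definition laurent_binomial_ideal :: "('a::field \<Rightarrow> 'a) \<Rightarrow> ('a, 'n::finite) laurent set \<Rightarrow> bool" where
  "laurent_binomial_ideal \<sigma> I \<longleftrightarrow>
     (\<exists>B. (\<forall>p\<in>B. laurent_binomial p) \<and> I = sigma_ideal (laurent_sigma \<sigma>) hull B)"

definition support_lattice :: "('a::field, 'n::finite) laurent set \<Rightarrow> (int poly ^ 'n) set" where
  "support_lattice I =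
     {f. \<exists>c. c \<noteq> 0 \<and> Poly_Mapping.single f 1 - Poly_Mapping.single 0 c \<in> I}"

text \<open>Here \<open>monom a k\<close> is the polynomial $a x^k$.\<close>

definition sat :: "(int poly ^ 'n::finite) set \<Rightarrow> (int poly ^ 'n) set" where
  "sat L = {f. \<exists>a k. a \<noteq> 0 \<and> monom a k *s f \<in> L}"

text \<open>The operator on Laurent difference polynomials is an endomorphism extending \<open>\<sigma>\<close>.\<close>

lemma laurent_sigma_superset:
  assumes "sigma_field \<sigma>" "finite A" "Poly_Mapping.keys p \<subseteq> A"
  shows "laurent_sigma \<sigma> p =
    (\<Sum>f\<in>A. Poly_Mapping.single (monom 1 1 *s f) (\<sigma> (Poly_Mapping.lookup p f)))"
proof -
  have "\<sigma> 0 = 0"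
    using assms(1) by (simp add: sigma_field_def)
  then show ?thesis
    unfolding laurent_sigma_def using assms(2,3)
    by (intro sum.mono_neutral_left) (auto simp: in_keys_iff)
qed

lemma laurent_sigma_single:
  assumes "sigma_field \<sigma>"
  shows "laurent_sigma \<sigma> (Poly_Mapping.single f c) =
    Poly_Mapping.single (monom 1 1 *s f) (\<sigma> c)"
  using laurent_sigma_superset[OF assms, of "{f}" "Poly_Mapping.single f c"] by simp

lemma laurent_sigma_one:
  assumes "sigma_field \<sigma>"
  shows "laurent_sigma \<sigma> 1 = 1"
  using laurent_sigma_single[OF assms, of 0 1] assms by (simp add: sigma_field_def)

lemma laurent_sigma_add:
  assumes "sigma_field \<sigma>"
  shows "laurent_sigma \<sigma> (p + q) = laurent_sigma \<sigma> p + laurent_sigma \<sigma> q"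
proof -
  let ?A = "Poly_Mapping.keys p \<union> Poly_Mapping.keys q"
  have "\<sigma> (a + b) = \<sigma> a + \<sigma> b" for a b
    using assms by (simp add: sigma_field_def)
  then show ?thesis
    using laurent_sigma_superset[OF assms, of ?A] keys_add[of p q]
    by (simp add: lookup_add single_add sum.distrib)
qed

lemma laurent_sigma_mult:
  assumes "sigma_field \<sigma>"
  shows "laurent_sigma \<sigma> (p * q) = laurent_sigma \<sigma> p * laurent_sigma \<sigma> q"
proof -
  have 0: "laurent_sigma \<sigma> 0 = 0"
    by (simp add: laurent_sigma_def)
  have sum: "laurent_sigma \<sigma> (\<Sum>i\<in>A. h i) = (\<Sum>i\<in>A. laurent_sigma \<sigma> (h i))"
    if "finite A" for A and h :: "int poly ^ 'b \<Rightarrow> ('a, 'b) laurent"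
    using that by induction (simp_all add: 0 laurent_sigma_add[OF assms])
  have rep: "r = (\<Sum>f\<in>Poly_Mapping.keys r. Poly_Mapping.single f (Poly_Mapping.lookup r f))"
    for r :: "('a, 'b) laurent"
    by (rule poly_mapping_eqI) (simp add: lookup_sum lookup_single when_def in_keys_iff)
  have "\<sigma> (a * b) = \<sigma> a * \<sigma> b" for a b
    using assms by (simp add: sigma_field_def)
  then have "laurent_sigma \<sigma> (Poly_Mapping.single f a * Poly_Mapping.single g b) =
      laurent_sigma \<sigma> (Poly_Mapping.single f a) * laurent_sigma \<sigma> (Poly_Mapping.single g b)"
    for f g :: "int poly ^ 'b" and a b
    by (simp add: mult_single laurent_sigma_single[OF assms] vector_add_ldistrib)
  then show ?thesis
    by (subst (1 2) rep[of p], subst (1 2) rep[of q]) (simp add: sum_product sum)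
qed

end

theory Submission
  imports Defs
begin

text \<open>
  A perfect ideal is the intersection of the reflexive prime \<open>\<sigma>\<close>-ideals that contain it
  (\<open>perfect_separating_prime\<close>), and conversely every reflexive prime is perfect. It therefore
  suffices to find, below each reflexive prime \<open>Q\<close> that contains \<open>I\<close>, a reflexive prime binomial
  ideal \<open>P\<close> with \<open>I \<subseteq> P \<subseteq> Q\<close> and support lattice \<open>L\<^sub>S\<close> (\<open>binomial_prime_below\<close>). The
  intersection of all reflexive prime binomial ideals with this lattice that contain \<open>I\<close> is then the
  perfect closure of \<open>I\<close>, and if there is none, then no reflexive prime contains \<open>I\<close> and the
  closure is the unit ideal.

  To construct \<open>P\<close>, let \<open>a x\<^sup>k f \<in> L\<close> with \<open>a \<noteq> 0\<close>. A binomial \<open>Y\<^bsup>a x^k f\<^esup> - d\<close> of \<open>I\<close>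
  factors over the algebraically closed field into binomials with exponent \<open>x\<^sup>k f\<close>, and \<open>Q\<close>
  contains one of the factors; as \<open>\<sigma>\<close> is onto and \<open>Q\<close> is reflexive, \<open>Q\<close> contains a binomial
  \<open>Y\<^sup>f - \<rho> f\<close> (\<open>sat_support_lattice_reflexive_prime\<close>). Its constant is unique, so \<open>\<rho>\<close> is a
  character of \<open>L\<^sub>S\<close> that commutes with \<open>\<sigma>\<close>, and \<open>P\<close> is the ideal generated by
  all \<open>Y\<^sup>f - \<rho> f\<close>.

  Modulo \<open>P\<close> the Laurent difference polynomials form a twisted group algebra of \<open>Z[x]\<^sup>n / L\<^sub>S\<close>.
  This quotient group is torsion-free because \<open>L\<^sub>S\<close> is saturated, hence it can be totally
  ordered, and comparing leading terms shows that \<open>P\<close> is prime (\<open>prime_char_ideal\<close>). The group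
  algebra is not formed as a type: membership in \<open>P\<close> is expressed by the vanishing of one linear
  functional for each coset of \<open>L\<^sub>S\<close>, and the order on the quotient becomes a total preorder of
  \<open>Z[x]\<^sup>n\<close>.
\<close>

section \<open>Perfect ideals are intersections of reflexive prime ideals\<close>

lemma sigma_idealD:
  assumes "sigma_ideal s J"
  shows "0 \<in> J" "p \<in> J \<Longrightarrow> q \<in> J \<Longrightarrow> p + q \<in> J" "p \<in> J \<Longrightarrow> r * p \<in> J" "p \<in> J \<Longrightarrow> p * r \<in> J"
    "p \<in> J \<Longrightarrow> s p \<in> J" "p \<in> J \<Longrightarrow> q \<in> J \<Longrightarrow> p - q \<in> J"
proof -
  note I = assms[unfolded sigma_ideal_iff]
  show "0 \<in> J" "p \<in> J \<Longrightarrow> q \<in> J \<Longrightarrow> p + q \<in> J" "p \<in> J \<Longrightarrow> r * p \<in> J" "p \<in> J \<Longrightarrow> p * r \<in> J"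
    "p \<in> J \<Longrightarrow> s p \<in> J"
    using I by (metis mult.commute)+
  assume "p \<in> J" "q \<in> J"
  then have "p + (- 1) * q \<in> J"
    using I by blast
  then show "p - q \<in> J"
    by simp
qed

lemma sigma_ideal_eq_UNIV:
  assumes "sigma_ideal s J" "u \<in> J" "v * u = 1"
  shows "J = UNIV"
proof -
  have "1 \<in> J"
    using sigma_idealD(3)[OF assms(1,2), of v] assms(3) by simp
  then have "r * 1 \<in> J" for r
    using sigma_idealD(3)[OF assms(1)] by blast
  then show ?thesis
    by auto
qed

lemma in_chain_common:
  assumes "subset.chain \<A> \<C>" "a \<in> \<Union>\<C>" "b \<in> \<Union>\<C>"
  shows "\<exists>X\<in>\<C>. a \<in> X \<and> b \<in> X"
proof -
  obtain X Y where XY: "X \<in> \<C>" "Y \<in> \<C>" "a \<in> X" "b \<in> Y"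
    using assms(2,3) by blast
  moreover have "X \<subseteq> Y \<or> Y \<subseteq> X"
    using assms(1) XY by (simp add: subset_chain_def)
  ultimately show ?thesis
    by blast
qed

lemma sigma_ideal_hull: "sigma_ideal s (sigma_ideal s hull B)"
  by (rule hull_in) (auto simp: sigma_ideal_iff)

lemma sigma_power_monom: "sigma_power s p (monom 1 i) = (s ^^ i) p"
proof -
  have "sigma_power s p (monom 1 i) = (\<Prod>j\<le>i. if j = i then (s ^^ i) p else 1)"
    unfolding sigma_power_def degree_monom_eq[OF one_neq_zero] by (rule prod.cong) auto
  then show ?thesis
    by simp
qed

lemma perfect_imp_reflexive:
  assumes "perfect_sigma_ideal s J"
  shows "reflexive_sigma_ideal s J"
proof -
  have "p \<in> J" if "s p \<in> J" for p
  proof -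
    have "sigma_power s p (monom 1 1) \<in> J"
      unfolding sigma_power_monom using that by simp
    then show ?thesis
      using assms unfolding perfect_sigma_ideal_def by (metis monom_eq_0_iff one_neq_zero)
  qed
  then show ?thesis
    using assms by (simp add: reflexive_sigma_ideal_def perfect_sigma_ideal_def)
qed

lemma reflexive_funpow:
  assumes "reflexive_sigma_ideal s J" "(s ^^ i) p \<in> J"
  shows "p \<in> J"
  using assms(2) by (induction i) (use assms(1) in \<open>auto simp: reflexive_sigma_ideal_def\<close>)

lemma prime_prod_in:
  assumes "prime_sigma_ideal s J" "finite A" "prod h A \<in> J"
  shows "\<exists>i\<in>A. h i \<in> J"
  using assms(2,3)
proof (induction A)
  case empty
  then have "J = UNIV"
    using assms(1) sigma_ideal_eq_UNIV[of s J 1 1] by (simp add: prime_sigma_ideal_def)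
  then show ?case
    using assms(1) by (simp add: prime_sigma_ideal_def)
next
  case (insert x A)
  then show ?case
    using assms(1) by (auto simp: prime_sigma_ideal_def)
qed

lemma prime_reflexive_imp_perfect:
  assumes "prime_sigma_ideal s J" "reflexive_sigma_ideal s J"
  shows "perfect_sigma_ideal s J"
proof -
  have "p \<in> J" if a: "sigma_power s p a \<in> J" for p a
  proof -
    obtain i where "((s ^^ i) p) ^ coeff a i \<in> J"
      using prime_prod_in[OF assms(1) finite_atMost a[unfolded sigma_power_def]] by (elim bexE)
    then have "(\<Prod>j<coeff a i. (s ^^ i) p) \<in> J"
      by simp
    then have "(s ^^ i) p \<in> J"
      using prime_prod_in[OF assms(1) finite_lessThan] by (metis (no_types))
    then show ?thesis
      using reflexive_funpow assms(2) by blast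
  qed
  then show ?thesis
    using assms(2) unfolding perfect_sigma_ideal_def reflexive_sigma_ideal_def by blast
qed

text \<open>
  The product of \<open>a * s b\<close> with its own image under \<open>s\<close> is a multiple of
  \<open>s (a * b) = s a * s b\<close>, and perfectness removes the exponent \<open>1 + x\<close>.
\<close>

lemma perfect_mult_sigma:
  assumes mult: "\<And>a b. s (a * b) = s a * s b"
    and J: "perfect_sigma_ideal s J" and ab: "a * b \<in> J"
  shows "a * s b \<in> J"
proof -
  have sJ: "sigma_ideal s J"
    using J by (simp add: perfect_sigma_ideal_def)
  have "s (a * b) * (a * s (s b)) \<in> J"
    using sJ ab by (blast intro: sigma_idealD)
  moreover have "s (a * b) * (a * s (s b)) = sigma_power s (a * s b) [:1, 1:]"
    by (simp add: sigma_power_def mult mult_ac)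
  ultimately show ?thesis
    using J unfolding perfect_sigma_ideal_def by (metis pCons_eq_0_iff one_neq_zero)
qed

lemma perfect_mult_funpow:
  assumes mult: "\<And>a b. s (a * b) = s a * s b"
    and J: "perfect_sigma_ideal s J" and ab: "a * b \<in> J"
  shows "a * (s ^^ i) b \<in> J"
  by (induction i) (use ab perfect_mult_sigma[OF mult J] in auto)

lemma sigma_power_mult:
  assumes mult: "\<And>a b. s (a * b) = s a * s b"
  shows "sigma_power s (a * b) u = sigma_power s a u * sigma_power s b u"
proof -
  have "(s ^^ i) (a * b) = (s ^^ i) a * (s ^^ i) b" for i
    by (induction i) (auto simp: mult)
  then show ?thesis
    by (simp add: sigma_power_def power_mult_distrib prod.distrib)
qed

text \<open>
  If \<open>r\<^sup>u * b\<close> lies in the perfect ideal then so does \<open>r\<^sup>u\<close> times any transform of \<open>b\<close>, hence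
  also \<open>r\<^sup>u * b\<^sup>u = (r * b)\<^sup>u\<close>.
\<close>

lemma perfect_colon:
  assumes mult: "\<And>a b. s (a * b) = s a * s b"
    and J: "perfect_sigma_ideal s J"
  shows "perfect_sigma_ideal s {r. r * b \<in> J}"
proof -
  have sJ: "sigma_ideal s J"
    using J by (simp add: perfect_sigma_ideal_def)
  have "s r * b \<in> J" if "r * b \<in> J" for r
    using perfect_mult_sigma[OF mult J, of b r] that by (simp add: mult.commute)
  then have "sigma_ideal s {r. r * b \<in> J}"
    using sigma_idealD[OF sJ] by (auto simp: sigma_ideal_iff distrib_right mult.assoc)
  moreover have "r * b \<in> J" if "u \<noteq> 0" and ru: "sigma_power s r u * b \<in> J" for r u
  proof -
    have "(s ^^ degree u) b dvd sigma_power s b u"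
      unfolding sigma_power_def using that(1)
      by (intro dvd_trans[OF dvd_power dvd_prodI[where a = "degree u"]])
        (auto simp: leading_coeff_neq_0 neq0_conv[symmetric] simp del: neq0_conv)
    then obtain t where "sigma_power s b u = (s ^^ degree u) b * t"
      by (auto simp: dvd_def)
    then have "sigma_power s (r * b) u = t * (sigma_power s r u * (s ^^ degree u) b)"
      by (simp add: sigma_power_mult[OF mult] mult_ac)
    then have "sigma_power s (r * b) u \<in> J"
      using perfect_mult_funpow[OF mult J ru] sigma_idealD(3)[OF sJ] by metis
    then show ?thesis
      using J that(1) by (auto simp: perfect_sigma_ideal_def)
  qed
  ultimately show ?thesis
    by (auto simp: perfect_sigma_ideal_def)
qed

text \<open>
  An ideal \<open>M\<close> maximal among the perfect ideals that avoid \<open>p\<close> is prime: if \<open>a * b \<in> M\<close> with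
  neither factor in \<open>M\<close>, then the colon ideal \<open>M : b\<close> is perfect and contains \<open>M\<close> properly, hence
  contains \<open>p\<close>; so \<open>b\<close> lies in \<open>M : p\<close>, which therefore also contains \<open>p\<close>, that is
  \<open>p\<^sup>2 \<in> M\<close>.
\<close>

lemma perfect_separating_prime:
  assumes mult: "\<And>a b. s (a * b) = s a * s b"
    and J: "perfect_sigma_ideal s J" and p: "p \<notin> J"
  shows "\<exists>Q. reflexive_sigma_ideal s Q \<and> prime_sigma_ideal s Q \<and> J \<subseteq> Q \<and> p \<notin> Q"
proof -
  define \<A> where "\<A> = {M. perfect_sigma_ideal s M \<and> J \<subseteq> M \<and> p \<notin> M}"
  have "\<exists>M\<in>\<A>. \<forall>X\<in>\<A>. M \<subseteq> X \<longrightarrow> X = M"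
  proof (rule subset_Zorn_nonempty)
    show "\<A> \<noteq> {}"
      using J p by (auto simp: \<A>_def)
    fix \<C> assume ne: "\<C> \<noteq> {}" and ch: "subset.chain \<A> \<C>"
    have C: "\<And>M. M \<in> \<C> \<Longrightarrow> perfect_sigma_ideal s M \<and> J \<subseteq> M \<and> p \<notin> M"
      using ch by (auto simp: subset.chain_def \<A>_def)
    have two: "\<exists>M\<in>\<C>. a \<in> M \<and> b \<in> M" if "a \<in> \<Union>\<C>" "b \<in> \<Union>\<C>" for a b
      using that by (rule in_chain_common[OF ch])
    have "a + b \<in> \<Union>\<C>" if ab: "a \<in> \<Union>\<C>" "b \<in> \<Union>\<C>" for a b
    proof -
      obtain M where "M \<in> \<C>" "a \<in> M" "b \<in> M"
        using two[OF ab] by blast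
      then show ?thesis
        using C[of M] unfolding perfect_sigma_ideal_def sigma_ideal_iff by blast
    qed
    moreover have "0 \<in> \<Union>\<C>"
      using ne C unfolding perfect_sigma_ideal_def sigma_ideal_iff by blast
    moreover have "r * a \<in> \<Union>\<C>" "s a \<in> \<Union>\<C>" if "a \<in> \<Union>\<C>" for a r
      using that C unfolding perfect_sigma_ideal_def sigma_ideal_iff by blast+
    ultimately have "sigma_ideal s (\<Union>\<C>)"
      unfolding sigma_ideal_iff by blast
    then have "perfect_sigma_ideal s (\<Union>\<C>)"
      using C unfolding perfect_sigma_ideal_def by blast
    then show "\<Union>\<C> \<in> \<A>"
      using ne C by (auto simp: \<A>_def)
  qed
  then obtain M where "M \<in> \<A>" and max': "\<And>X. X \<in> \<A> \<Longrightarrow> M \<subseteq> X \<Longrightarrow> X = M"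
    by blast
  then have M: "perfect_sigma_ideal s M" "J \<subseteq> M" "p \<notin> M"
    and max: "\<And>X. perfect_sigma_ideal s X \<Longrightarrow> M \<subseteq> X \<Longrightarrow> p \<notin> X \<Longrightarrow> X = M"
    by (auto simp: \<A>_def)
  have sM: "sigma_ideal s M"
    using M by (simp add: perfect_sigma_ideal_def)
  have colon: "p * b \<in> M" if "a * b \<in> M" "a \<notin> M" for a b
  proof (rule ccontr)
    assume "p * b \<notin> M"
    then have "{r. r * b \<in> M} = M"
      using sigma_idealD(4)[OF sM] by (intro max perfect_colon mult M) auto
    then show False
      using that by blast
  qed
  have "a \<in> M \<or> b \<in> M" if "a * b \<in> M" for a b
  proof (rule ccontr)
    assume neg: "\<not> ?thesis"
    then have "b * p \<in> M"
      using colon[OF that] by (simp add: mult.commute)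
    then have "p * p \<in> M"
      using colon neg by blast
    then have "sigma_power s p [:2:] \<in> M"
      by (simp add: sigma_power_def power2_eq_square)
    moreover have "[:2::nat:] \<noteq> 0"
      by simp
    ultimately show False
      using M unfolding perfect_sigma_ideal_def by blast
  qed
  then have "prime_sigma_ideal s M"
    using sM M(3) by (auto simp: prime_sigma_ideal_def)
  then show ?thesis
    using M perfect_imp_reflexive by blast
qed

section \<open>A translation-invariant total preorder modulo a pure subgroup\<close>

text \<open>
  A translation-invariant preorder is given by its cone \<open>C\<close> of elements above \<open>0\<close>; two elements
  are equivalent when their difference lies in \<open>C \<inter> - C\<close>.
\<close>

lemma cone_multiple:
  fixes C :: "('r::comm_ring_1 ^ 'n::finite) set"
  assumes "0 \<in> C" "\<And>a b. a \<in> C \<Longrightarrow> b \<in> C \<Longrightarrow> a + b \<in> C" "a \<in> C"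
  shows "of_nat n *s a \<in> C"
  by (induction n) (use assms in \<open>auto simp: vector_sadd_rdistrib\<close>)

text \<open>
  Purity of \<open>M\<close> says that the quotient by \<open>M\<close> is torsion-free. A maximal cone meeting its negative
  exactly in \<open>M\<close> is total: if neither \<open>a\<close> nor \<open>- a\<close> could be adjoined, then the cone would
  contain positive multiples of both, so a positive multiple of \<open>a\<close> would lie in \<open>M\<close>.
\<close>

lemma total_cone_exists:
  fixes M :: "('r::comm_ring_1 ^ 'n::finite) set"
  assumes M0: "0 \<in> M" and Madd: "\<And>a b. a \<in> M \<Longrightarrow> b \<in> M \<Longrightarrow> a + b \<in> M"
    and Mneg: "\<And>a. a \<in> M \<Longrightarrow> - a \<in> M"
    and pure: "\<And>n a. n > 0 \<Longrightarrow> of_nat n *s a \<in> M \<Longrightarrow> a \<in> M"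
  obtains C where "\<And>a b. a \<in> C \<Longrightarrow> b \<in> C \<Longrightarrow> a + b \<in> C"
    "\<And>a. a \<in> C \<or> - a \<in> C" "\<And>a. a \<in> C \<and> - a \<in> C \<longleftrightarrow> a \<in> M"
proof -
  define \<A> where "\<A> = {C. M \<subseteq> C \<and> (\<forall>a\<in>C. \<forall>b\<in>C. a + b \<in> C) \<and> (\<forall>a. a \<in> C \<longrightarrow> - a \<in> C \<longrightarrow> a \<in> M)}"
  have "\<exists>C\<in>\<A>. \<forall>X\<in>\<A>. C \<subseteq> X \<longrightarrow> X = C"
  proof (rule subset_Zorn_nonempty)
    show "\<A> \<noteq> {}"
      using Madd by (auto simp: \<A>_def)
    fix \<C> assume ne: "\<C> \<noteq> {}" and ch: "subset.chain \<A> \<C>"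
    have C: "\<And>X. X \<in> \<C> \<Longrightarrow> X \<in> \<A>"
      using ch by (auto simp: subset.chain_def)
    have two: "\<exists>X\<in>\<C>. a \<in> X \<and> b \<in> X" if "a \<in> \<Union>\<C>" "b \<in> \<Union>\<C>" for a b
      using that by (rule in_chain_common[OF ch])
    have "a + b \<in> \<Union>\<C>" if ab: "a \<in> \<Union>\<C>" "b \<in> \<Union>\<C>" for a b
      using two[OF ab] C unfolding \<A>_def by blast
    moreover have "a \<in> M" if ab: "a \<in> \<Union>\<C>" "- a \<in> \<Union>\<C>" for a
      using two[OF ab] C unfolding \<A>_def by blast
    moreover have "M \<subseteq> \<Union>\<C>"
      using ne C unfolding \<A>_def by blast
    ultimately show "\<Union>\<C> \<in> \<A>"
      unfolding \<A>_def by blast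
  qed
  then obtain C where "C \<in> \<A>" and max: "\<And>X. X \<in> \<A> \<Longrightarrow> C \<subseteq> X \<Longrightarrow> X = C"
    by blast
  then have MC: "M \<subseteq> C" and add: "\<And>a b. a \<in> C \<Longrightarrow> b \<in> C \<Longrightarrow> a + b \<in> C"
    and ker: "\<And>a. a \<in> C \<Longrightarrow> - a \<in> C \<Longrightarrow> a \<in> M"
    by (auto simp: \<A>_def)
  have C0: "0 \<in> C"
    using M0 MC by blast
  \<comment> \<open>Adjoining \<open>g\<close> to the maximal cone must create a new pair \<open>a\<close>, \<open>- a\<close>; adding these two
    elements shows that a positive multiple of \<open>- g\<close> was already present.\<close>
  have step: "\<exists>n>0. - (of_nat n *s g) \<in> C" if g: "g \<notin> C" for g
  proof -
    define D where "D = {c + of_nat n *s g | c n. c \<in> C}"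
    have "C \<subseteq> D"
    proof
      fix c assume "c \<in> C"
      moreover have "c = c + of_nat 0 *s g"
        by simp
      ultimately show "c \<in> D"
        unfolding D_def by blast
    qed
    have "g = 0 + of_nat 1 *s g"
      by simp
    then have "g \<in> D"
      unfolding D_def using C0 by blast
    have Dadd: "a + b \<in> D" if ab: "a \<in> D" "b \<in> D" for a b
    proof -
      obtain c n d m where "c \<in> C" "d \<in> C" "a = c + of_nat n *s g" "b = d + of_nat m *s g"
        using ab unfolding D_def by blast
      moreover from this have "a + b = (c + d) + of_nat (n + m) *s g"
        by (simp add: vector_sadd_rdistrib algebra_simps)
      ultimately show ?thesis
        unfolding D_def using add by blast
    qed
    have "D \<notin> \<A>"
      using max[of D] \<open>C \<subseteq> D\<close> \<open>g \<in> D\<close> g by blast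
    then obtain a where a: "a \<in> D" "- a \<in> D" "a \<notin> M"
      using Dadd \<open>C \<subseteq> D\<close> MC by (auto simp: \<A>_def)
    then obtain c n d m where cd: "c \<in> C" "d \<in> C" "a = c + of_nat n *s g" "- a = d + of_nat m *s g"
      unfolding D_def by blast
    have "n + m > 0"
    proof (rule ccontr)
      assume "\<not> n + m > 0"
      then have "a \<in> C" "- a \<in> C"
        using cd by auto
      then show False
        using ker a(3) by blast
    qed
    moreover have "(c + d) + of_nat (n + m) *s g = a + - a"
      unfolding cd(4) unfolding cd(3) by (simp add: vector_sadd_rdistrib algebra_simps)
    then have "- (of_nat (n + m) *s g) = c + d"
      by (simp add: eq_neg_iff_add_eq_0 add.commute neg_eq_iff_add_eq_0)
    ultimately show ?thesis
      using add cd(1,2) by metis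
  qed
  have total: "a \<in> C \<or> - a \<in> C" for a
  proof (rule ccontr)
    assume neg: "\<not> ?thesis"
    then obtain n m where nm: "n > 0" "- (of_nat n *s a) \<in> C" "m > 0" "of_nat m *s a \<in> C"
      using step[of a] step[of "- a"] by (auto simp: vector_smult_rneg)
    have "of_nat (n * m) *s a \<in> C"
      using cone_multiple[OF C0 add nm(4), of n] by (simp add: vector_smult_assoc)
    moreover have "- (of_nat (n * m) *s a) \<in> C"
      using cone_multiple[OF C0 add nm(2), of m]
      by (simp add: vector_smult_assoc vector_smult_rneg mult.commute)
    ultimately have "of_nat (n * m) *s a \<in> M"
      using ker by blast
    then show False
      using pure[of "n * m" a] nm MC neg by auto
  qed
  show ?thesis
    by (rule that[OF add total]) (use MC Mneg ker in auto)
qed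

lemma cone_maximum:
  fixes C :: "'g::ab_group_add set"
  assumes add: "\<And>a b. a \<in> C \<Longrightarrow> b \<in> C \<Longrightarrow> a + b \<in> C" and total: "\<And>a. a \<in> C \<or> - a \<in> C"
    and "finite S" "S \<noteq> {}"
  shows "\<exists>g\<in>S. \<forall>f\<in>S. g - f \<in> C"
  using assms(3,4)
proof (induction rule: finite_ne_induct)
  case (singleton x)
  then show ?case
    using total[of 0] by simp
next
  case (insert x F)
  then obtain g where g: "g \<in> F" "\<And>f. f \<in> F \<Longrightarrow> g - f \<in> C"
    by blast
  show ?case
  proof (cases "g - x \<in> C")
    case True
    then show ?thesis
      using g by blast
  next
    case False
    then have "x - g \<in> C"
      using total[of "g - x"] by simp
    then have "x - f \<in> C" if "f \<in> F" for f
      using add[OF _ g(2)[OF that], of "x - g"] by simp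
    then show ?thesis
      using total[of 0] by auto
  qed
qed

section \<open>Roots of monomials modulo a prime ideal\<close>

text \<open>
  Over an algebraically closed field the image of a polynomial splits into factors \<open>t - C c\<close>,
  and a prime ideal that contains the product contains one of them.
\<close>

lemma prime_contains_root:
  fixes C :: "'a::alg_closed_field \<Rightarrow> 'r::comm_ring_1"
  assumes Q: "prime_sigma_ideal s Q"
    and C: "C 0 = 0" "C 1 = 1" "\<And>a b. C (a + b) = C a + C b" "\<And>a b. C (a * b) = C a * C b"
    and "p \<noteq> 0" "poly (map_poly C p) t \<in> Q"
  shows "\<exists>c. t - C c \<in> Q"
  using assms(6,7)
proof (induction "degree p" arbitrary: p)
  case 0
  then obtain a where p: "p = [:a:]"
    by (metis degree_eq_zeroE)
  with 0 have "a \<noteq> 0" "C a \<in> Q"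
    by (auto simp: map_poly_pCons C)
  moreover have "C (inverse a) * C a = 1"
    using \<open>a \<noteq> 0\<close> by (simp add: C flip: C(4))
  ultimately have "Q = UNIV"
    using Q sigma_ideal_eq_UNIV by (auto simp: prime_sigma_ideal_def)
  then show ?case
    by blast
next
  case (Suc n)
  then obtain c where "poly p c = 0"
    using alg_closed_imp_poly_has_root[of p] by auto
  then obtain q where p: "p = [:- c, 1:] * q"
    by (auto simp: poly_eq_0_iff_dvd dvd_def)
  have Cm: "C (- a) = - C a" for a
    using C(3)[of a "- a"] C(1) by (simp add: eq_neg_iff_add_eq_0 add.commute)
  have Cd: "C (a - b) = C a - C b" for a b
    using C(3)[of a "- b"] Cm by simp
  have map_p: "map_poly C p = [:- C c, 1:] * map_poly C q"
    unfolding p by (rule poly_eqI) (auto simp: coeff_map_poly C Cm Cd coeff_pCons split: nat.split)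
  have "poly (map_poly C p) t = (t - C c) * poly (map_poly C q) t"
    unfolding map_p by (simp add: algebra_simps)
  then have "(t - C c) * poly (map_poly C q) t \<in> Q"
    using Suc.prems(2) by simp
  then consider "t - C c \<in> Q" | "poly (map_poly C q) t \<in> Q"
    using Q unfolding prime_sigma_ideal_def by blast
  then show ?case
  proof cases
    case 2
    have "q \<noteq> 0"
      using Suc.prems(1) p by auto
    moreover have "n = degree q"
      using Suc.hyps(2) \<open>q \<noteq> 0\<close> unfolding p by (subst (asm) degree_mult_eq) auto
    ultimately show ?thesis
      using Suc.hyps(1) 2 by blast
  qed blast
qed

section \<open>The ideal of a saturated equivariant partial character\<close>

lemma laurent_expansion:
  "p = (\<Sum>f\<in>Poly_Mapping.keys p. Poly_Mapping.single f (Poly_Mapping.lookup p f))"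
  by (rule poly_mapping_eqI) (simp add: lookup_sum lookup_single when_def in_keys_iff)

text \<open>
  A character on a subgroup \<open>M\<close> of the exponents is encoded as a total function that vanishes
  exactly off \<open>M\<close>. The multiplicative law, stated for \<open>l \<in> M\<close> and arbitrary \<open>h\<close>, then also says
  that \<open>M\<close> is a subgroup, since then \<open>h + l \<in> M\<close> exactly when \<open>h \<in> M\<close>.
\<close>

locale saturated_character =
  fixes \<sigma> :: "'a::field \<Rightarrow> 'a" and \<rho> :: "int poly ^ 'n::finite \<Rightarrow> 'a"
  assumes sigma: "sigma_field \<sigma>"
    and rho_0 [simp]: "\<rho> 0 = 1"
    and rho_add: "\<rho> l \<noteq> 0 \<Longrightarrow> \<rho> (h + l) = \<rho> h * \<rho> l"
    and rho_shift: "\<rho> (monom 1 1 *s f) = \<sigma> (\<rho> f)"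
    and rho_pure: "n > 0 \<Longrightarrow> \<rho> (of_nat n *s f) \<noteq> 0 \<Longrightarrow> \<rho> f \<noteq> 0"
begin

lemma sigma_simps: "\<sigma> 0 = 0" "\<sigma> 1 = 1" "\<sigma> (a + b) = \<sigma> a + \<sigma> b" "\<sigma> (a * b) = \<sigma> a * \<sigma> b"
    "\<sigma> a = 0 \<longleftrightarrow> a = 0"
  using sigma by (auto simp: sigma_field_def)

lemma sigma_sum: "\<sigma> (sum h A) = (\<Sum>i\<in>A. \<sigma> (h i))"
  by (induction A rule: infinite_finite_induct) (auto simp: sigma_simps)

lemma rho_neg: "\<rho> l \<noteq> 0 \<Longrightarrow> \<rho> (- l) * \<rho> l = 1"
  using rho_add[of l "- l"] by simp

lemma rho_neg_neq_0: "\<rho> l \<noteq> 0 \<Longrightarrow> \<rho> (- l) \<noteq> 0"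
  using rho_neg by fastforce

text \<open>
  Only the exponents in the coset of \<open>g\<close> contribute. Replacing each such monomial \<open>Y\<^sup>f\<close> by
  \<open>\<rho> (f - g) Y\<^sup>g\<close>, which is congruent to it modulo the binomials of \<open>\<rho>\<close>, collects
  \<open>coset_sum g p\<close> as the coefficient of \<open>Y\<^sup>g\<close>.
\<close>

definition coset_sum :: "int poly ^ 'n \<Rightarrow> ('a, 'n) laurent \<Rightarrow> 'a" where
  "coset_sum g p = (\<Sum>f\<in>Poly_Mapping.keys p. Poly_Mapping.lookup p f * \<rho> (f - g))"

definition char_ideal :: "('a, 'n) laurent set" where
  "char_ideal = {p. \<forall>g. coset_sum g p = 0}"

definition char_binomials :: "('a, 'n) laurent set" where
  "char_binomials = {Poly_Mapping.single f 1 - Poly_Mapping.single 0 (\<rho> f) | f. \<rho> f \<noteq> 0}"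

lemma coset_sum_superset:
  assumes "finite A" "Poly_Mapping.keys p \<subseteq> A"
  shows "coset_sum g p = (\<Sum>f\<in>A. Poly_Mapping.lookup p f * \<rho> (f - g))"
  unfolding coset_sum_def using assms by (intro sum.mono_neutral_left) (auto simp: in_keys_iff)

lemma coset_sum_add: "coset_sum g (p + q) = coset_sum g p + coset_sum g q"
  using coset_sum_superset[of "Poly_Mapping.keys p \<union> Poly_Mapping.keys q"] keys_add[of p q]
  by (simp add: lookup_add distrib_right sum.distrib)

lemma coset_sum_single: "coset_sum g (Poly_Mapping.single f c) = c * \<rho> (f - g)"
  using coset_sum_superset[of "{f}" "Poly_Mapping.single f c"] by simp

lemma coset_sum_0 [simp]: "coset_sum g 0 = 0"
  by (simp add: coset_sum_def)

lemma coset_sum_sum: "coset_sum g (sum h A) = (\<Sum>i\<in>A. coset_sum g (h i))"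
  by (induction A rule: infinite_finite_induct) (auto simp: coset_sum_add)

lemma coset_sum_diff: "coset_sum g (p - q) = coset_sum g p - coset_sum g q"
  using coset_sum_add[of g "p - q" q] by simp

lemma coset_sum_mult:
  "coset_sum g (p * q) = (\<Sum>a\<in>Poly_Mapping.keys p. \<Sum>b\<in>Poly_Mapping.keys q.
     Poly_Mapping.lookup p a * Poly_Mapping.lookup q b * \<rho> (a + b - g))"
  by (subst laurent_expansion[of p], subst laurent_expansion[of q])
    (simp add: sum_product coset_sum_sum coset_sum_single mult_single)

lemma coset_sum_mult':
  "coset_sum g (p * q) =
     (\<Sum>a\<in>Poly_Mapping.keys p. Poly_Mapping.lookup p a * coset_sum (g - a) q)"
  unfolding coset_sum_mult unfolding coset_sum_def sum_distrib_left
  by (intro sum.cong refl) (simp add: algebra_simps)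

lemma coset_sum_laurent_sigma:
  "coset_sum g (laurent_sigma \<sigma> p) =
     (\<Sum>f\<in>Poly_Mapping.keys p. \<sigma> (Poly_Mapping.lookup p f) * \<rho> (monom 1 1 *s f - g))"
  by (simp add: laurent_sigma_def coset_sum_sum coset_sum_single)

lemma coset_sum_laurent_sigma_shift:
  "coset_sum (monom 1 1 *s g) (laurent_sigma \<sigma> p) = \<sigma> (coset_sum g p)"
  unfolding coset_sum_laurent_sigma unfolding coset_sum_def
  by (simp only: sigma_sum sigma_simps vector_ssub_ldistrib[symmetric] rho_shift)

text \<open>
  For closure under \<open>laurent_sigma \<sigma>\<close>, consider the coset of \<open>g\<close>. Either it contains no
  exponent of the form \<open>x f\<close>, and the coset sum is empty, or it contains some \<open>x e\<close>, and up to a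
  constant factor the coset sum is the one at \<open>x e\<close>, which is \<open>\<sigma>\<close> of the coset sum of \<open>p\<close>
  at \<open>e\<close>.
\<close>

lemma sigma_ideal_char_ideal: "sigma_ideal (laurent_sigma \<sigma>) char_ideal"
proof -
  have "coset_sum g (laurent_sigma \<sigma> p) = 0" if p: "p \<in> char_ideal" for p g
  proof (cases "\<exists>f. \<rho> (monom 1 1 *s f - g) \<noteq> 0")
    case True
    then obtain e where e: "\<rho> (monom 1 1 *s e - g) \<noteq> 0"
      by blast
    have eq: "\<rho> (monom 1 1 *s f - g) = \<rho> (monom 1 1 *s f - monom 1 1 *s e) * \<rho> (monom 1 1 *s e - g)"
      for f
      using rho_add[OF e, of "monom 1 1 *s f - monom 1 1 *s e"] by simp
    have "coset_sum g (laurent_sigma \<sigma> p) =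
        coset_sum (monom 1 1 *s e) (laurent_sigma \<sigma> p) * \<rho> (monom 1 1 *s e - g)"
      unfolding coset_sum_laurent_sigma sum_distrib_right mult.assoc
      by (intro sum.cong refl) (subst eq, rule refl)
    also have "\<dots> = 0"
      using p unfolding coset_sum_laurent_sigma_shift by (simp add: char_ideal_def sigma_simps)
    finally show ?thesis .
  qed (simp add: coset_sum_laurent_sigma)
  then show ?thesis
    by (auto simp: sigma_ideal_iff char_ideal_def coset_sum_add coset_sum_mult')
qed

lemma char_binomials_subset: "char_binomials \<subseteq> char_ideal"
proof
  fix p assume "p \<in> char_binomials"
  then obtain f where f: "\<rho> f \<noteq> 0" "p = Poly_Mapping.single f 1 - Poly_Mapping.single 0 (\<rho> f)"
    by (auto simp: char_binomials_def)
  have "coset_sum g p = 0" for g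
    using rho_add[OF f(1), of "- g"] by (simp add: f(2) coset_sum_diff coset_sum_single)
  then show "p \<in> char_ideal"
    by (simp add: char_ideal_def)
qed

definition reduced :: "('a, 'n) laurent \<Rightarrow> bool" where
  "reduced p \<longleftrightarrow> (\<forall>f\<in>Poly_Mapping.keys p. \<forall>g\<in>Poly_Mapping.keys p. \<rho> (f - g) \<noteq> 0 \<longrightarrow> f = g)"

lemma coset_sum_reduced:
  assumes "reduced p" "g \<in> Poly_Mapping.keys p"
  shows "coset_sum g p = Poly_Mapping.lookup p g"
proof -
  have "coset_sum g p = (\<Sum>f\<in>Poly_Mapping.keys p. if f = g then Poly_Mapping.lookup p g else 0)"
    unfolding coset_sum_def using assms by (intro sum.cong) (auto simp: reduced_def)
  then show ?thesis
    using assms(2) by simp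
qed

lemma reduced_in_char_ideal:
  assumes "reduced p" "p \<in> char_ideal"
  shows "p = 0"
proof (rule ccontr)
  assume "p \<noteq> 0"
  then obtain g where g: "g \<in> Poly_Mapping.keys p"
    by (metis all_not_in_conv keys_eq_empty)
  then have "Poly_Mapping.lookup p g = 0"
    using coset_sum_reduced[OF assms(1) g] assms(2) by (simp add: char_ideal_def)
  then show False
    using g by (simp add: in_keys_iff)
qed

text \<open>
  If two exponents \<open>f \<noteq> g\<close> of \<open>p\<close> are congruent modulo the support of \<open>\<rho>\<close>, then subtracting a
  multiple of the binomial for \<open>f - g\<close> merges the term at \<open>f\<close> into the one at \<open>g\<close>, and the number
  of terms drops.
\<close>

lemma reduced_representative:
  "\<exists>q. reduced q \<and> p - q \<in> sigma_ideal (laurent_sigma \<sigma>) hull char_binomials"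
proof (induction "card (Poly_Mapping.keys p)" arbitrary: p rule: less_induct)
  case less
  let ?H = "sigma_ideal (laurent_sigma \<sigma>) hull char_binomials"
  have H: "sigma_ideal (laurent_sigma \<sigma>) ?H"
    by (rule sigma_ideal_hull)
  show ?case
  proof (cases "reduced p")
    case True
    moreover have "p - p \<in> ?H"
      using sigma_idealD(1)[OF H] by simp
    ultimately show ?thesis
      by blast
  next
    case False
    then obtain f g where fg: "f \<in> Poly_Mapping.keys p" "g \<in> Poly_Mapping.keys p"
        "\<rho> (f - g) \<noteq> 0" "f \<noteq> g"
      by (auto simp: reduced_def)
    define c where "c = Poly_Mapping.lookup p f"
    define b where "b = Poly_Mapping.single g c *
      (Poly_Mapping.single (f - g) 1 - Poly_Mapping.single 0 (\<rho> (f - g)))"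
    have b: "b = Poly_Mapping.single f c - Poly_Mapping.single g (c * \<rho> (f - g))"
      by (simp add: b_def right_diff_distrib mult_single)
    have "b \<in> ?H"
      unfolding b_def using fg(3)
      by (intro sigma_idealD(3)[OF H] hull_inc) (auto simp: char_binomials_def)
    have "Poly_Mapping.keys (p - b) \<subseteq> Poly_Mapping.keys p - {f}"
      using fg by (auto simp: b c_def in_keys_iff lookup_minus lookup_single when_def split: if_splits)
    then have "card (Poly_Mapping.keys (p - b)) < card (Poly_Mapping.keys p)"
      using fg(1) by (intro psubset_card_mono) auto
    then obtain q where "reduced q" "p - b - q \<in> ?H"
      using less by blast
    moreover have "p - q = (p - b - q) + b"
      by simp
    ultimately show ?thesis
      using sigma_idealD(2)[OF H _ \<open>b \<in> ?H\<close>] by metis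
  qed
qed

text \<open>
  Modulo the binomials every element of \<open>char_ideal\<close> is congruent to a reduced polynomial, whose
  coset sums at its exponents are its coefficients; as they vanish, the polynomial is \<open>0\<close>.
\<close>

lemma char_ideal_eq_hull: "char_ideal = sigma_ideal (laurent_sigma \<sigma>) hull char_binomials"
proof
  show sub: "sigma_ideal (laurent_sigma \<sigma>) hull char_binomials \<subseteq> char_ideal"
    using char_binomials_subset sigma_ideal_char_ideal by (rule hull_minimal)
  show "char_ideal \<subseteq> sigma_ideal (laurent_sigma \<sigma>) hull char_binomials"
  proof
    fix p assume p: "p \<in> char_ideal"
    obtain q where q: "reduced q" "p - q \<in> sigma_ideal (laurent_sigma \<sigma>) hull char_binomials"
      using reduced_representative by blast
    then have "p - (p - q) \<in> char_ideal"
      using sigma_idealD(6)[OF sigma_ideal_char_ideal p, of "p - q"] sub by blast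
    then have "q = 0"
      using reduced_in_char_ideal[OF q(1)] by simp
    then show "p \<in> sigma_ideal (laurent_sigma \<sigma>) hull char_binomials"
      using q(2) by simp
  qed
qed

lemma laurent_binomial_char_ideal: "laurent_binomial_ideal \<sigma> char_ideal"
proof -
  have "laurent_binomial p" if p: "p \<in> char_binomials" for p
  proof -
    obtain f where "p = Poly_Mapping.single f 1 - Poly_Mapping.single 0 (\<rho> f)"
      using p unfolding char_binomials_def by blast
    then have "p = Poly_Mapping.single f 1 + Poly_Mapping.single 0 (- \<rho> f)"
      by (simp add: single_uminus)
    then show ?thesis
      unfolding laurent_binomial_def by blast
  qed
  then show ?thesis
    unfolding laurent_binomial_ideal_def using char_ideal_eq_hull by blast
qed

lemma reflexive_char_ideal: "reflexive_sigma_ideal (laurent_sigma \<sigma>) char_ideal"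
proof -
  have "coset_sum g p = 0" if "laurent_sigma \<sigma> p \<in> char_ideal" for g p
    using that coset_sum_laurent_sigma_shift[of g p] by (simp add: char_ideal_def sigma_simps)
  then show ?thesis
    using sigma_ideal_char_ideal by (simp add: reflexive_sigma_ideal_def char_ideal_def)
qed

text \<open>
  A polynomial outside the ideal may be replaced by a reduced one, whose exponents lie in distinct
  cosets. In the total preorder modulo the support of \<open>\<rho>\<close> two such polynomials, being nonzero,
  have unique leading exponents \<open>g\<close> and \<open>h\<close>, and \<open>(g, h)\<close> is the only pair of exponents that contributes to the
  coset sum of the product at \<open>g + h\<close>.
\<close>

lemma prime_char_ideal: "prime_sigma_ideal (laurent_sigma \<sigma>) char_ideal"
proof -
  note K = sigma_idealD[OF sigma_ideal_char_ideal]
  obtain C where add: "\<And>a b. a \<in> C \<Longrightarrow> b \<in> C \<Longrightarrow> a + b \<in> C"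
    and total: "\<And>a. a \<in> C \<or> - a \<in> C"
    and ker: "\<And>a. a \<in> C \<and> - a \<in> C \<longleftrightarrow> a \<in> {f. \<rho> f \<noteq> 0}"
  proof (rule total_cone_exists)
    show "0 \<in> {f. \<rho> f \<noteq> 0}"
      by simp
    show "a + b \<in> {f. \<rho> f \<noteq> 0}" if "a \<in> {f. \<rho> f \<noteq> 0}" "b \<in> {f. \<rho> f \<noteq> 0}" for a b
      using that by (simp add: rho_add)
    show "- a \<in> {f. \<rho> f \<noteq> 0}" if "a \<in> {f. \<rho> f \<noteq> 0}" for a
      using that by (simp add: rho_neg_neq_0)
    show "a \<in> {f. \<rho> f \<noteq> 0}" if "n > 0" "of_nat n *s a \<in> {f. \<rho> f \<noteq> 0}" for n a
      using that rho_pure by simp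
  qed blast
  have eq: "u = 0 \<or> v = 0" if red: "reduced u" "reduced v" and uv: "u * v \<in> char_ideal" for u v
  proof (rule ccontr)
    assume neg: "\<not> ?thesis"
    obtain g where g: "g \<in> Poly_Mapping.keys u" "\<And>f. f \<in> Poly_Mapping.keys u \<Longrightarrow> g - f \<in> C"
      using cone_maximum[OF add total, of "Poly_Mapping.keys u"] neg by auto
    obtain h where h: "h \<in> Poly_Mapping.keys v" "\<And>f. f \<in> Poly_Mapping.keys v \<Longrightarrow> h - f \<in> C"
      using cone_maximum[OF add total, of "Poly_Mapping.keys v"] neg by auto
    have uniq: "a = g \<and> b = h"
      if ab: "a \<in> Poly_Mapping.keys u" "b \<in> Poly_Mapping.keys v" and c: "\<rho> (a + b - (g + h)) \<noteq> 0"
      for a b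
    proof -
      have m: "a + b - (g + h) \<in> C"
        using c ker by blast
      have "- (g - a) = (h - b) + (a + b - (g + h))" "- (h - b) = (g - a) + (a + b - (g + h))"
        by (simp_all add: algebra_simps)
      then have "- (g - a) \<in> C" "- (h - b) \<in> C"
        using add[OF h(2)[OF ab(2)] m] add[OF g(2)[OF ab(1)] m] by simp_all
      then have "\<rho> (g - a) \<noteq> 0" "\<rho> (h - b) \<noteq> 0"
        using ker[of "g - a"] ker[of "h - b"] g(2)[OF ab(1)] h(2)[OF ab(2)] by auto
      then show ?thesis
        using red ab g(1) h(1) by (auto simp: reduced_def)
    qed
    have "coset_sum (g + h) (u * v) = (\<Sum>a\<in>Poly_Mapping.keys u. \<Sum>b\<in>Poly_Mapping.keys v.
        if b = h then if a = g then Poly_Mapping.lookup u g * Poly_Mapping.lookup v h else 0 else 0)"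
      unfolding coset_sum_mult using uniq by (intro sum.cong refl) auto
    also have "\<dots> = Poly_Mapping.lookup u g * Poly_Mapping.lookup v h"
      using g(1) h(1) by simp
    finally show False
      using uv g(1) h(1) by (simp add: char_ideal_def in_keys_iff)
  qed
  have "p \<in> char_ideal \<or> q \<in> char_ideal" if pq: "p * q \<in> char_ideal" for p q
  proof -
    obtain u v where u: "reduced u" "p - u \<in> char_ideal" and v: "reduced v" "q - v \<in> char_ideal"
      using reduced_representative[of p] reduced_representative[of q]
      unfolding char_ideal_eq_hull[symmetric] by blast
    have "p * q - ((p - u) * q + u * (q - v)) \<in> char_ideal"
      by (intro K(6)[OF pq] K(2) K(4)[OF u(2)] K(3)[OF v(2)])
    moreover have "p * q - ((p - u) * q + u * (q - v)) = u * v"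
      by (simp add: algebra_simps)
    ultimately have "u = 0 \<or> v = 0"
      using eq u(1) v(1) by simp
    then show ?thesis
      using u(2) v(2) by auto
  qed
  moreover have "Poly_Mapping.single 0 1 \<notin> char_ideal"
    unfolding char_ideal_def mem_Collect_eq
    by (rule notI, drule spec[of _ 0]) (simp add: coset_sum_single del: single_one)
  ultimately show ?thesis
    using sigma_ideal_char_ideal by (auto simp: prime_sigma_ideal_def)
qed

lemma support_lattice_char_ideal: "support_lattice char_ideal = {f. \<rho> f \<noteq> 0}"
proof -
  have "\<rho> f \<noteq> 0"
    if "c \<noteq> 0" "Poly_Mapping.single f 1 - Poly_Mapping.single 0 c \<in> char_ideal" for f c
    using that rho_neg_neq_0[of "- f"]
    by (auto simp: char_ideal_def coset_sum_diff coset_sum_single dest!: spec[of _ 0])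
  moreover have "Poly_Mapping.single f 1 - Poly_Mapping.single 0 (\<rho> f) \<in> char_ideal"
    if "\<rho> f \<noteq> 0" for f
    using that char_binomials_subset by (auto simp: char_binomials_def)
  ultimately show ?thesis
    by (auto simp: support_lattice_def)
qed

end

section \<open>Support lattices and their saturation\<close>

lemma support_latticeI:
  assumes "c \<noteq> 0" "Poly_Mapping.single f 1 - Poly_Mapping.single 0 c \<in> J"
  shows "f \<in> support_lattice J"
  using assms by (auto simp: support_lattice_def)

lemma support_latticeE:
  assumes "f \<in> support_lattice J"
  obtains c where "c \<noteq> 0" "Poly_Mapping.single f 1 - Poly_Mapping.single 0 c \<in> J"
  using assms by (auto simp: support_lattice_def)

lemma laurent_sigma_diff:
  assumes "sigma_field \<sigma>"
  shows "laurent_sigma \<sigma> (p - q) = laurent_sigma \<sigma> p - laurent_sigma \<sigma> q"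
  using laurent_sigma_add[OF assms, of "p - q" q] by simp

lemma laurent_sigma_binomial:
  assumes "sigma_field \<sigma>"
  shows "laurent_sigma \<sigma> (Poly_Mapping.single f 1 - Poly_Mapping.single 0 c) =
    Poly_Mapping.single (monom 1 1 *s f) 1 - Poly_Mapping.single 0 (\<sigma> c)"
  using assms by (simp add: laurent_sigma_diff laurent_sigma_single) (simp add: sigma_field_def)

lemma laurent_sigma_funpow_binomial:
  assumes "sigma_field \<sigma>"
  shows "(laurent_sigma \<sigma> ^^ k) (Poly_Mapping.single f 1 - Poly_Mapping.single 0 c) =
    Poly_Mapping.single (monom 1 k *s f) 1 - Poly_Mapping.single 0 ((\<sigma> ^^ k) c)"
proof (induction k)
  case 0
  then show ?case
    by (simp add: monom_0 one_pCons[symmetric])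
next
  case (Suc k)
  then show ?case
    by (simp add: laurent_sigma_binomial[OF assms] vector_smult_assoc mult_monom)
qed

lemma binomial_add:
  assumes "sigma_ideal s J" "Poly_Mapping.single f 1 - Poly_Mapping.single 0 c \<in> J"
    "Poly_Mapping.single g 1 - Poly_Mapping.single 0 d \<in> (J :: ('a::field, 'n::finite) laurent set)"
  shows "Poly_Mapping.single (f + g) 1 - Poly_Mapping.single 0 (c * d) \<in> J"
proof -
  have "Poly_Mapping.single g 1 * (Poly_Mapping.single f 1 - Poly_Mapping.single 0 c) +
      Poly_Mapping.single 0 c * (Poly_Mapping.single g 1 - Poly_Mapping.single 0 d) \<in> J"
    using sigma_idealD[OF assms(1)] assms(2,3) by blast
  then show ?thesis
    by (simp add: right_diff_distrib mult_single add.commute)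
qed

lemma support_lattice_closed:
  fixes J :: "('a::field, 'n::finite) laurent set"
  assumes J: "sigma_ideal (laurent_sigma \<sigma>) J" and \<sigma>: "sigma_field \<sigma>"
  shows support_lattice_0: "0 \<in> support_lattice J"
    and support_lattice_add:
      "\<And>f g. f \<in> support_lattice J \<Longrightarrow> g \<in> support_lattice J \<Longrightarrow> f + g \<in> support_lattice J"
    and support_lattice_uminus: "\<And>f. f \<in> support_lattice J \<Longrightarrow> - f \<in> support_lattice J"
    and support_lattice_shift: "\<And>f. f \<in> support_lattice J \<Longrightarrow> monom 1 1 *s f \<in> support_lattice J"
proof -
  show "0 \<in> support_lattice J"
    using sigma_idealD(1)[OF J] by (intro support_latticeI[of 1]) auto
  show "f + g \<in> support_lattice J" if "f \<in> support_lattice J" "g \<in> support_lattice J" for f g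
    using that by (elim support_latticeE) (rule support_latticeI[OF _ binomial_add[OF J]], auto)
  show "- f \<in> support_lattice J" if "f \<in> support_lattice J" for f
    using that
  proof (rule support_latticeE)
    fix c :: 'a assume c: "c \<noteq> 0" "Poly_Mapping.single f 1 - Poly_Mapping.single 0 c \<in> J"
    have "Poly_Mapping.single (- f) (- inverse c) *
        (Poly_Mapping.single f 1 - Poly_Mapping.single 0 c) \<in> J"
      by (rule sigma_idealD(3)[OF J c(2)])
    moreover have "Poly_Mapping.single (- f) (- inverse c) *
        (Poly_Mapping.single f 1 - Poly_Mapping.single 0 c) =
        Poly_Mapping.single (- f) 1 - Poly_Mapping.single 0 (inverse c)"
      using c(1) by (simp add: right_diff_distrib mult_single single_uminus)
    ultimately show ?thesis
      using c(1) by (intro support_latticeI[of "inverse c"]) auto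
  qed
  show "monom 1 1 *s f \<in> support_lattice J" if "f \<in> support_lattice J" for f
    using that
  proof (rule support_latticeE)
    fix c :: 'a assume "c \<noteq> 0" "Poly_Mapping.single f 1 - Poly_Mapping.single 0 c \<in> J"
    then show ?thesis
      using sigma_idealD(5)[OF J, of "Poly_Mapping.single f 1 - Poly_Mapping.single 0 c"] \<sigma>
      by (intro support_latticeI[of "\<sigma> c"])
        (simp_all add: laurent_sigma_binomial[OF \<sigma>], simp add: sigma_field_def)
  qed
qed

lemma monom_smult_closed:
  fixes L :: "(int poly ^ 'n::finite) set"
  assumes "0 \<in> L" and add: "\<And>f g. f \<in> L \<Longrightarrow> g \<in> L \<Longrightarrow> f + g \<in> L"
    and neg: "\<And>f. f \<in> L \<Longrightarrow> - f \<in> L" and shift: "\<And>f. f \<in> L \<Longrightarrow> monom 1 1 *s f \<in> L"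
    and f: "f \<in> L"
  shows "monom a k *s f \<in> L"
proof -
  have pow: "monom 1 k *s f \<in> L"
  proof (induction k)
    case (Suc k)
    then show ?case
      using shift[OF Suc] by (simp add: vector_smult_assoc mult_monom)
  qed (use f in \<open>simp add: monom_0 one_pCons[symmetric]\<close>)
  have nat: "monom (int n) k *s f \<in> L" for n
  proof (induction n)
    case (Suc n)
    have "monom (int (Suc n)) k = monom (int n) k + monom 1 k"
      by (simp add: add_monom)
    then show ?case
      using add[OF Suc pow] by (simp add: vector_sadd_rdistrib)
  qed (use assms(1) in simp)
  show ?thesis
  proof (cases "a \<ge> 0")
    case True
    then show ?thesis
      using nat[of "nat a"] by simp
  next
    case False
    then have "- (monom (int (nat (- a))) k *s f) = monom a k *s f"
      by (simp flip: vector_smult_lneg minus_monom)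
    then show ?thesis
      using neg[OF nat[of "nat (- a)"]] by simp
  qed
qed

lemma sat_closed:
  fixes L :: "(int poly ^ 'n::finite) set"
  assumes L: "0 \<in> L" "\<And>f g. f \<in> L \<Longrightarrow> g \<in> L \<Longrightarrow> f + g \<in> L"
    "\<And>f. f \<in> L \<Longrightarrow> - f \<in> L" "\<And>f. f \<in> L \<Longrightarrow> monom 1 1 *s f \<in> L"
  shows sat_superset: "L \<subseteq> sat L"
    and sat_add: "\<And>f g. f \<in> sat L \<Longrightarrow> g \<in> sat L \<Longrightarrow> f + g \<in> sat L"
    and sat_uminus: "\<And>f. f \<in> sat L \<Longrightarrow> - f \<in> sat L"
    and sat_shift_iff: "\<And>f. monom 1 1 *s f \<in> sat L \<longleftrightarrow> f \<in> sat L"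
    and sat_pure: "\<And>n f. n > 0 \<Longrightarrow> of_nat n *s f \<in> sat L \<Longrightarrow> f \<in> sat L"
proof -
  note smult = monom_smult_closed[OF L]
  have satI: "f \<in> sat L" if "a \<noteq> 0" "monom a k *s f \<in> L" for f a k
    using that by (auto simp: sat_def)
  show "L \<subseteq> sat L"
    using satI[of 1 0] by (auto simp: monom_0 one_pCons[symmetric])
  show "f + g \<in> sat L" if fg: "f \<in> sat L" "g \<in> sat L" for f g
  proof -
    obtain a k b l where ab: "a \<noteq> 0" "b \<noteq> 0" "monom a k *s f \<in> L" "monom b l *s g \<in> L"
      using fg by (auto simp: sat_def)
    have "monom (a * b) (k + l) *s (f + g) = monom b l *s (monom a k *s f) + monom a k *s (monom b l *s g)"
      by (simp add: vector_add_ldistrib vector_smult_assoc mult_monom ac_simps)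
    then have "monom (a * b) (k + l) *s (f + g) \<in> L"
      using L(2) smult ab(3,4) by metis
    then show ?thesis
      using ab(1,2) by (intro satI[of "a * b"]) auto
  qed
  show "- f \<in> sat L" if "f \<in> sat L" for f
    using that L(3) by (auto simp: sat_def vector_smult_rneg)
  show "monom 1 1 *s f \<in> sat L \<longleftrightarrow> f \<in> sat L" for f
  proof
    assume "monom 1 1 *s f \<in> sat L"
    then show "f \<in> sat L"
      by (auto simp: sat_def vector_smult_assoc mult_monom)
  next
    assume "f \<in> sat L"
    then obtain a k where "a \<noteq> 0" "monom a k *s f \<in> L"
      by (auto simp: sat_def)
    moreover from this have "monom a k *s (monom 1 1 *s f) \<in> L"
      using L(4)[of "monom a k *s f"] by (simp add: vector_smult_assoc mult.commute)
    ultimately show "monom 1 1 *s f \<in> sat L"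
      using satI by blast
  qed
  show "f \<in> sat L" if n: "n > 0" "of_nat n *s f \<in> sat L" for n f
  proof -
    obtain a k where ak: "a \<noteq> 0" "monom a k *s (of_nat n *s f) \<in> L"
      using n(2) by (auto simp: sat_def)
    have "monom a k * of_nat n = monom (a * int n) k"
      by (simp add: of_nat_monom mult_monom)
    then show ?thesis
      using ak n(1) by (intro satI[of "a * int n" k]) (auto simp: vector_smult_assoc)
  qed
qed

lemma single_power:
  fixes h :: "'r::comm_ring_1 ^ 'n::finite"
  shows "Poly_Mapping.single h (1::'a::comm_ring_1) ^ n = Poly_Mapping.single (of_nat n *s h) 1"
  by (induction n) (auto simp: mult_single vector_sadd_rdistrib)

lemma single_notin_prime:
  assumes "prime_sigma_ideal s (Q :: ('a::field, 'n::finite) laurent set)" "c \<noteq> 0"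
  shows "Poly_Mapping.single f c \<notin> Q"
proof
  assume "Poly_Mapping.single f c \<in> Q"
  moreover have "Poly_Mapping.single (- f) (inverse c) * Poly_Mapping.single f c = 1"
    using assms(2) by (simp add: mult_single)
  ultimately have "Q = UNIV"
    using assms(1) sigma_ideal_eq_UNIV unfolding prime_sigma_ideal_def by blast
  then show False
    using assms(1) by (simp add: prime_sigma_ideal_def)
qed

lemma binomial_constant_unique:
  assumes Q: "prime_sigma_ideal s (Q :: ('a::field, 'n::finite) laurent set)"
    and "Poly_Mapping.single f 1 - Poly_Mapping.single 0 c \<in> Q"
    and "Poly_Mapping.single f 1 - Poly_Mapping.single 0 d \<in> Q"
  shows "c = d"
proof -
  have "sigma_ideal s Q"
    using Q by (simp add: prime_sigma_ideal_def)
  from sigma_idealD(6)[OF this assms(2,3)] have "Poly_Mapping.single 0 (d - c) \<in> Q"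
    by (simp add: single_diff)
  then show ?thesis
    using single_notin_prime[OF Q, of "d - c" 0] by auto
qed

text \<open>
  If \<open>Y\<^bsup>nh\<^esup> - d\<close> lies in the prime ideal, where \<open>h = x\<^sup>k f\<close>, then so does \<open>Y\<^sup>h - c\<close> for
  one of the roots \<open>c\<close> of \<open>z\<^sup>n = d\<close>. The latter is the image under \<open>\<sigma>\<^sup>k\<close> of a binomial with
  exponent \<open>f\<close>, because \<open>\<sigma>\<close> is onto, and reflexivity removes \<open>\<sigma>\<^sup>k\<close>.
\<close>

lemma sat_support_lattice_reflexive_prime:
  fixes Q :: "('a::alg_closed_field, 'n::finite) laurent set"
  assumes \<sigma>: "inversive_sigma_field \<sigma>" and Q: "prime_sigma_ideal (laurent_sigma \<sigma>) Q"
    and refl: "reflexive_sigma_ideal (laurent_sigma \<sigma>) Q"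
  shows "sat (support_lattice Q) \<subseteq> support_lattice Q"
proof
  have sQ: "sigma_ideal (laurent_sigma \<sigma>) Q" and sf: "sigma_field \<sigma>"
    using Q \<sigma> by (auto simp: prime_sigma_ideal_def inversive_sigma_field_def)
  have root: "\<exists>c. Poly_Mapping.single h 1 - Poly_Mapping.single 0 c \<in> Q"
    if "n > 0" "of_nat n *s h \<in> support_lattice Q" for n h
    using that(2)
  proof (rule support_latticeE)
    fix d :: 'a
    assume d: "Poly_Mapping.single (of_nat n *s h) 1 - Poly_Mapping.single 0 d \<in> Q"
    define p where "p = monom 1 n + [:- d:]"
    have "coeff p n = 1"
      using that(1) by (simp add: p_def coeff_pCons split: nat.split)
    then have "p \<noteq> 0"
      by auto
    have "map_poly (Poly_Mapping.single (0 :: int poly ^ 'n)) p =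
        monom 1 n + [:Poly_Mapping.single 0 (- d):]"
      by (rule poly_eqI) (auto simp: p_def coeff_map_poly coeff_pCons single_add split: nat.split)
    then have "poly (map_poly (Poly_Mapping.single 0) p) (Poly_Mapping.single h 1) \<in> Q"
      using d by (simp add: poly_monom single_power single_uminus)
    from prime_contains_root[OF Q _ _ _ _ \<open>p \<noteq> 0\<close> this] show ?thesis
      by (simp add: single_add mult_single)
  qed
  fix f assume "f \<in> sat (support_lattice Q)"
  then obtain a k where a: "a \<noteq> 0" "monom a k *s f \<in> support_lattice Q"
    by (auto simp: sat_def)
  define n where "n = nat \<bar>a\<bar>"
  have "monom \<bar>a\<bar> k *s f \<in> support_lattice Q"
    using a support_lattice_uminus[OF sQ sf a(2)]
    by (auto simp: abs_if vector_smult_lneg simp flip: minus_monom)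
  moreover have "of_nat n *s (monom 1 k *s f) = monom \<bar>a\<bar> k *s f"
    by (simp add: n_def vector_smult_assoc of_nat_monom mult_monom)
  ultimately obtain c where c: "Poly_Mapping.single (monom 1 k *s f) 1 - Poly_Mapping.single 0 c \<in> Q"
    using root[of n "monom 1 k *s f"] a(1) by (auto simp: n_def)
  have "surj (\<sigma> ^^ k)"
    using \<sigma> by (intro surj_fn bij_is_surj) (simp add: inversive_sigma_field_def)
  then obtain e where e: "c = (\<sigma> ^^ k) e"
    by blast
  have "(laurent_sigma \<sigma> ^^ k) (Poly_Mapping.single f 1 - Poly_Mapping.single 0 e) \<in> Q"
    using c by (simp add: laurent_sigma_funpow_binomial[OF sf] e)
  then have "Poly_Mapping.single f 1 - Poly_Mapping.single 0 e \<in> Q"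
    by (rule reflexive_funpow[OF refl])
  moreover from this have "e \<noteq> 0"
    using single_notin_prime[OF Q, of 1 f] by auto
  ultimately show "f \<in> support_lattice Q"
    by (intro support_latticeI)
qed

section \<open>The binomial primes below a reflexive prime\<close>

text \<open>
  For \<open>f\<close> in the saturation of the support lattice of \<open>I\<close> there is exactly one constant \<open>c\<close> such
  that \<open>Q\<close> contains \<open>Y\<^sup>f - c\<close>. These constants form an equivariant character, whose ideal lies
  between \<open>I\<close> and \<open>Q\<close>.
\<close>

lemma binomial_prime_below:
  fixes I Q :: "('a::alg_closed_field, 'n::finite) laurent set"
  assumes \<sigma>: "inversive_sigma_field \<sigma>" and I: "laurent_binomial_ideal \<sigma> I"
    and Q: "prime_sigma_ideal (laurent_sigma \<sigma>) Q"
    and refl: "reflexive_sigma_ideal (laurent_sigma \<sigma>) Q" and "I \<subseteq> Q"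
  shows "\<exists>P. laurent_binomial_ideal \<sigma> P \<and> reflexive_sigma_ideal (laurent_sigma \<sigma>) P \<and>
    prime_sigma_ideal (laurent_sigma \<sigma>) P \<and> support_lattice P = sat (support_lattice I) \<and>
    I \<subseteq> P \<and> P \<subseteq> Q"
proof -
  have sf: "sigma_field \<sigma>"
    using \<sigma> by (simp add: inversive_sigma_field_def)
  obtain B where B: "\<And>p. p \<in> B \<Longrightarrow> laurent_binomial p" "I = sigma_ideal (laurent_sigma \<sigma>) hull B"
    using I by (auto simp: laurent_binomial_ideal_def)
  have sI: "sigma_ideal (laurent_sigma \<sigma>) I"
    unfolding B(2) by (rule sigma_ideal_hull)
  have sQ: "sigma_ideal (laurent_sigma \<sigma>) Q"
    using Q by (simp add: prime_sigma_ideal_def)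
  define M where "M = sat (support_lattice I)"
  note sat = sat_closed[OF support_lattice_closed[OF sI sf], folded M_def]
  have "support_lattice I \<subseteq> support_lattice Q"
    using \<open>I \<subseteq> Q\<close> by (auto simp: support_lattice_def)
  then have "M \<subseteq> sat (support_lattice Q)"
    by (auto simp: M_def sat_def)
  then have MQ: "M \<subseteq> support_lattice Q"
    using sat_support_lattice_reflexive_prime[OF \<sigma> Q refl] by blast
  have M0: "0 \<in> M"
    using support_lattice_0[OF sI sf] sat(1) by blast
  define \<rho> where
    "\<rho> f = (if f \<in> M then THE c. Poly_Mapping.single f 1 - Poly_Mapping.single 0 c \<in> Q else 0)" for f
  have rho_eq: "\<rho> f = c"
    if "f \<in> M" "Poly_Mapping.single f 1 - Poly_Mapping.single 0 c \<in> Q" for f c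
    unfolding \<rho>_def using that binomial_constant_unique[OF Q] by auto
  have rho_in: "Poly_Mapping.single f 1 - Poly_Mapping.single 0 (\<rho> f) \<in> Q" and rho_nz: "\<rho> f \<noteq> 0"
    if "f \<in> M" for f
  proof -
    have "f \<in> support_lattice Q"
      using that MQ by blast
    then obtain c where "c \<noteq> 0" "Poly_Mapping.single f 1 - Poly_Mapping.single 0 c \<in> Q"
      by (rule support_latticeE)
    then show "Poly_Mapping.single f 1 - Poly_Mapping.single 0 (\<rho> f) \<in> Q" "\<rho> f \<noteq> 0"
      using rho_eq[OF that] by auto
  qed
  have rho_nz_iff: "\<rho> f \<noteq> 0 \<longleftrightarrow> f \<in> M" for f
    using rho_nz by (auto simp: \<rho>_def)
  interpret saturated_character \<sigma> \<rho>
  proof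
    show "sigma_field \<sigma>"
      by (rule sf)
    show "\<rho> 0 = 1"
      using sigma_idealD(1)[OF sQ] by (intro rho_eq[OF M0]) simp
    show "\<rho> (h + l) = \<rho> h * \<rho> l" if "\<rho> l \<noteq> 0" for h l
    proof (cases "h \<in> M")
      case True
      have l: "l \<in> M"
        using that rho_nz_iff by blast
      show ?thesis
        using True l by (intro rho_eq sat(2) binomial_add[OF sQ] rho_in)
    next
      case False
      have "h + l \<notin> M"
        using sat(2)[of "h + l" "- l"] sat(3)[of l] that rho_nz_iff False by auto
      then show ?thesis
        using False by (simp add: \<rho>_def)
    qed
    show "\<rho> (monom 1 1 *s f) = \<sigma> (\<rho> f)" for f
    proof (cases "f \<in> M")
      case True
      then show ?thesis
        using sigma_idealD(5)[OF sQ rho_in[OF True]] sat(4)[of f]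
        by (intro rho_eq) (auto simp only: laurent_sigma_binomial[OF sf])
    next
      case False
      then show ?thesis
        using sat(4)[of f] sf by (simp add: \<rho>_def sigma_field_def)
    qed
    show "\<rho> f \<noteq> 0" if "n > 0" "\<rho> (of_nat n *s f) \<noteq> 0" for n f
      using that sat(5) rho_nz_iff by blast
  qed
  have "p \<in> char_ideal" if p_B: "p \<in> B" for p
  proof -
    obtain a c g h where p: "p = Poly_Mapping.single g a + Poly_Mapping.single h c"
      using B(1)[OF p_B] unfolding laurent_binomial_def by blast
    have "p \<in> I"
      unfolding B(2) using that by (rule hull_inc)
    then have "p \<in> Q"
      using \<open>I \<subseteq> Q\<close> by blast
    show ?thesis
    proof (cases "a = 0")
      case True
      \<comment> \<open>A nonzero term is a unit and cannot lie in \<open>Q\<close>.\<close>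
      then have "p = 0"
        using p \<open>p \<in> Q\<close> single_notin_prime[OF Q, of c h] by (cases "c = 0") auto
      then show ?thesis
        using sigma_idealD(1)[OF sigma_ideal_char_ideal] by simp
    next
      case False
      define b where "b = Poly_Mapping.single (g - h) 1 - Poly_Mapping.single 0 (- (c / a))"
      have pb: "p = Poly_Mapping.single h a * b"
        using False by (simp add: p b_def distrib_left mult_single single_uminus)
      have "b = Poly_Mapping.single (- h) (inverse a) * p"
        using False by (simp add: p b_def distrib_left mult_single single_uminus divide_inverse mult.commute)
      then have "b \<in> I"
        using sigma_idealD(3)[OF sI \<open>p \<in> I\<close>] by simp
      then have "b \<in> Q"
        using \<open>I \<subseteq> Q\<close> by blast
      then have "- (c / a) \<noteq> 0"
        using single_notin_prime[OF Q, of 1 "g - h"] by (auto simp: b_def)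
      then have "g - h \<in> M"
        using \<open>b \<in> I\<close> sat(1) unfolding b_def by (blast intro: support_latticeI)
      moreover from this have "\<rho> (g - h) = - (c / a)"
        using \<open>b \<in> Q\<close> by (intro rho_eq) (simp_all add: b_def)
      ultimately have "b \<in> char_binomials"
        using rho_nz by (auto simp: char_binomials_def b_def intro!: exI[of _ "g - h"])
      then show ?thesis
        using char_binomials_subset unfolding pb
        by (intro sigma_idealD(3)[OF sigma_ideal_char_ideal]) blast
    qed
  qed
  then have "I \<subseteq> char_ideal"
    unfolding B(2) by (intro hull_minimal sigma_ideal_char_ideal) blast
  moreover have "char_binomials \<subseteq> Q"
    using rho_in rho_nz_iff by (auto simp: char_binomials_def)
  then have "char_ideal \<subseteq> Q"
    unfolding char_ideal_eq_hull using sQ by (rule hull_minimal)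
  moreover have "support_lattice char_ideal = sat (support_lattice I)"
    using support_lattice_char_ideal rho_nz_iff by (auto simp: M_def)
  ultimately show ?thesis
    using laurent_binomial_char_ideal reflexive_char_ideal prime_char_ideal by blast
qed

theorem theorem4p29:
  fixes \<sigma> :: "'a::{alg_closed_field, field_char_0} \<Rightarrow> 'a"
    and I :: "('a, 'n::finite) laurent set"
    and L L\<^sub>S :: "(int poly ^ 'n) set"
  assumes "inversive_sigma_field \<sigma>"
    and "laurent_binomial_ideal \<sigma> I"
    and "L = support_lattice I"
    and "L\<^sub>S = sat L"
  shows "perfect_closure (laurent_sigma \<sigma>) I = UNIV \<or>
    (\<exists>\<P>. \<P> \<noteq> {} \<and>
       (\<forall>P\<in>\<P>. laurent_binomial_ideal \<sigma> P \<and> reflexive_sigma_ideal (laurent_sigma \<sigma>) P \<and>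
          prime_sigma_ideal (laurent_sigma \<sigma>) P \<and> support_lattice P = L\<^sub>S) \<and>
       perfect_closure (laurent_sigma \<sigma>) I = \<Inter>\<P>)"
proof -
  let ?s = "laurent_sigma \<sigma>"
  \<comment> \<open>Requiring \<open>I \<subseteq> P\<close> is what places these ideals above the perfect closure.\<close>
  define \<P> where "\<P> = {P. laurent_binomial_ideal \<sigma> P \<and> reflexive_sigma_ideal ?s P \<and>
    prime_sigma_ideal ?s P \<and> support_lattice P = L\<^sub>S \<and> I \<subseteq> P}"
  have mult: "?s (a * b) = ?s a * ?s b" for a b
    using assms(1) by (intro laurent_sigma_mult) (simp add: inversive_sigma_field_def)
  have "perfect_closure ?s I \<subseteq> P" if "P \<in> \<P>" for P
    unfolding perfect_closure_def using that prime_reflexive_imp_perfect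
    by (intro hull_minimal) (auto simp: \<P>_def)
  moreover have separate: "\<exists>P\<in>\<P>. p \<notin> P" if "p \<notin> perfect_closure ?s I" for p
  proof -
    obtain J where J: "perfect_sigma_ideal ?s J" "I \<subseteq> J" "p \<notin> J"
      using \<open>p \<notin> perfect_closure ?s I\<close> by (auto simp: perfect_closure_def hull_def)
    then obtain Q where Q: "reflexive_sigma_ideal ?s Q" "prime_sigma_ideal ?s Q" "J \<subseteq> Q" "p \<notin> Q"
      using perfect_separating_prime[OF mult] by blast
    then show ?thesis
      using binomial_prime_below[OF assms(1,2) Q(2,1)] J(2) assms(3,4) unfolding \<P>_def by blast
  qed
  ultimately have "perfect_closure ?s I = \<Inter>\<P>"
    by blast
  moreover have "perfect_closure ?s I = UNIV \<or> \<P> \<noteq> {}"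
    using separate by blast
  moreover have "\<forall>P\<in>\<P>. laurent_binomial_ideal \<sigma> P \<and> reflexive_sigma_ideal ?s P \<and>
      prime_sigma_ideal ?s P \<and> support_lattice P = L\<^sub>S"
    by (simp add: \<P>_def)
  ultimately show ?thesis
    by metis
qed

end
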